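(* Let $n\ge 1$. Each of the following four sets of permutations has cardinality equal to the Motzkin number $M_n$: (1) the set of $\pi\in\mathfrak{S}_n(132)$ all of whose increasing runs have length at most two; (2) the set of $\pi\in\mathfrak{S}_n(132)$ all of whose LDE decreasing paths have length at most two; (3) the set of $\pi\in\mathfrak{S}_n(132)$ all of whose maximal v-CIS have length at most two; (4) the set of $\pi\in\mathfrak{S}_n(132)$ all of whose decreasing runs have length at most two.
   Context: The Motzkin numbers are defined by $\sum_{n\ge0}M_nx^n=\frac{1-x-\sqrt{1-2x-3x^2}}{2x^2}$. $\mathfrak{S}_n(132)$ is the set of permutations $\pi=\pi_1\cdots\pi_n$ of $[n]=\{1,\dots,n\}$ avoiding the pattern $132$ (no $i<j<k$ with $\pi_i<\pi_k<\pi_j$). An increasing (resp. decreasing) run of $\pi$ is a maximal subsequence $\pi_i\pi_{i+1}\cdots\pi_{i+k-1}$ of consecutive positions that is increasing (resp. decreasing). A v-CIS of $\pi$ is a subsequence $\pi_{i_1}\cdots\pi_{i_k}$ ($i_1<\cdots<i_k$) of the form $j(j+1)\cdots(j+k-1)$; the maximal v-CIS partition the entries of $\pi$. LDE decreasing paths of $\pi$ are obtained by applying to the word $\pi$ the following recursive procedure. For a word $w=w_1\cdots w_r$ of distinct integers with $r\ge1$: the first path consists of all right-to-left maxima of $w$ (entries $w_i$ with $w_i>w_j$ for all $i<j\le r$; $w_r$ is always included). If the leftmost element of this path is $w_s$ with $s>1$, form the next path from the right-to-left maxima of $w_1\cdots w_{s-1}$, and so on, until a path containing $w_1$ is obtained.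 Then, for every path found and every two adjacent elements $w_a,w_b$ ($a<b$) of that path with $b>a+1$, apply the same procedure to the word $w_{a+1}\cdots w_{b-1}$. Continue until every entry is in a path. The length of a path is the number of its elements. *)

theory Defs
  imports
    "HOL-Computational_Algebra.Formal_Power_Series"
    "HOL-Combinatorics.Multiset_Permutations"
    "HOL-Library.Sublist"
begin

(* The numerator has subdegree 2, so the division of power series is exact. The argument "root"
   selects the square root with constant term sqrt 1 = 1. *)
definition motzkin_fps :: "real fps" where
  "motzkin_fps =
     (1 - fps_X - fps_radical root 2 (1 - 2 * fps_X - 3 * fps_X ^ 2)) / (2 * fps_X ^ 2)"

definition motzkin :: "nat \<Rightarrow> real" where
  "motzkin n = fps_nth motzkin_fps n"

definition avoids_132 :: "nat list \<Rightarrow> bool" where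
  "avoids_132 w \<longleftrightarrow>
     \<not> (\<exists>i j k. i < j \<and> j < k \<and> k < length w \<and> w ! i < w ! k \<and> w ! k < w ! j)"

(* Permutations of [n] in one-line notation. *)
definition S132 :: "nat \<Rightarrow> nat list set" where
  "S132 n = {w \<in> permutations_of_set {1..n}. avoids_132 w}"

(* All words below have distinct entries, so a subsequence determines the positions it occupies.
   Hence runs and v-CIS can be given by their entries, and maximality is maximality with respect
   to "sublist" (consecutive positions) and "subseq" (arbitrary positions), respectively. *)

definition maximal_run :: "(nat \<Rightarrow> nat \<Rightarrow> bool) \<Rightarrow> nat list \<Rightarrow> nat list \<Rightarrow> bool" where
  "maximal_run R w u \<longleftrightarrow>
     u \<noteq> [] \<and> sublist u w \<and> sorted_wrt R u \<and>
     (\<forall>v. sublist v w \<and> sorted_wrt R v \<and> sublist u v \<longrightarrow> v = u)"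

definition increasing_run :: "nat list \<Rightarrow> nat list \<Rightarrow> bool" where
  "increasing_run = maximal_run (<)"

definition decreasing_run :: "nat list \<Rightarrow> nat list \<Rightarrow> bool" where
  "decreasing_run = maximal_run (>)"

definition v_CIS :: "nat list \<Rightarrow> nat list \<Rightarrow> bool" where
  "v_CIS w u \<longleftrightarrow> u \<noteq> [] \<and> subseq u w \<and> (\<exists>j k. u = [j..<j + k])"

definition maximal_v_CIS :: "nat list \<Rightarrow> nat list \<Rightarrow> bool" where
  "maximal_v_CIS w u \<longleftrightarrow> v_CIS w u \<and> (\<forall>v. v_CIS w v \<and> subseq u v \<longrightarrow> v = u)"

fun rl_maxima :: "nat list \<Rightarrow> nat list" where
  "rl_maxima [] = []"
| "rl_maxima (x # xs) = (if \<forall>y\<in>set xs. y < x then x # rl_maxima xs else rl_maxima xs)"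

(* The paths found in w before descending into gaps: "hd p" is the leftmost element of the path p,
   and u is the part of w strictly to its left. *)
inductive outer_path :: "nat list \<Rightarrow> nat list \<Rightarrow> bool" where
  first_path: "w \<noteq> [] \<Longrightarrow> outer_path w (rl_maxima w)"
| next_path: "outer_path w p \<Longrightarrow> w = u @ hd p # v \<Longrightarrow> u \<noteq> [] \<Longrightarrow> outer_path w (rl_maxima u)"

(* In the second rule, g is the nonempty gap of w between the adjacent elements a, b of p. *)
inductive LDE_path :: "nat list \<Rightarrow> nat list \<Rightarrow> bool" where
  outer: "outer_path w p \<Longrightarrow> LDE_path w p"
| gap: "outer_path w p \<Longrightarrow> p = xs @ a # b # ys \<Longrightarrow> w = u @ a # g @ b # v \<Longrightarrow> g \<noteq> [] \<Longrightarrow>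
    LDE_path g q \<Longrightarrow> LDE_path w q"

end

theory Submission
  imports Defs
begin

text \<open>
  A permutation of an interval avoids 132 iff it has the form \<open>L N R\<close> with maximum \<open>N\<close>, with \<open>L\<close> and
  \<open>R\<close> again avoiding 132, and with all entries of \<open>L\<close> above all entries of \<open>R\<close>. Hence these
  permutations are encoded by binary trees, and each of the four conditions becomes a recursive
  condition on the trees. Let \<open>A\<close> be the generating function of the good trees.

  For increasing runs, \<open>L\<close> must not end with an ascent; if \<open>B\<close> counts the good words without final
  ascent, then \<open>A = 1 + x B A\<close> and \<open>B = 1 + x + x B (B - 1)\<close>, whence \<open>B = 1 + x A\<close>. Decreasing runs
  are the same after reversal, that is, after reflecting the tree.

  For v-CIS, a new triple \<open>N - 2, N - 1, N\<close> arises iff \<open>N - 2\<close> precedes \<open>N - 1\<close> in \<open>L\<close>, i.e. iff the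
  left subtree of \<open>L\<close> is nonempty; again \<open>A = 1 + x (1 + x A) A\<close>.

  For LDE paths, the first path is \<open>N\<close> followed by the right-to-left maxima of \<open>R\<close>, and all other
  outer paths are those of \<open>L\<close>. So \<open>R\<close> is empty or ends with its maximum, the rest of \<open>R\<close> being a
  gap, and \<open>A = 1 + x A + x A (x A)\<close>.

  In all cases \<open>A = 1 + x A + x\<^sup>2 A\<^sup>2\<close>, so \<open>1 - x - 2 x\<^sup>2 A\<close> is the square root of
  \<open>1 - 2 x - 3 x\<^sup>2\<close> with constant term 1.
\<close>

section \<open>The pattern 132 and the decomposition at the maximum\<close>

text \<open>Fixing the position of the first letter peels off one existential quantifier; iterating
  from \<open>d = 0\<close> turns a subsequence into increasing indices.\<close>

lemma subseq_Cons_drop_iff: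
  "subseq (x # xs) (drop d w) \<longleftrightarrow>
    (\<exists>i\<ge>d. i < length w \<and> w ! i = x \<and> subseq xs (drop (Suc i) w))"
proof
  assume "subseq (x # xs) (drop d w)"
  then obtain us vs where dw: "drop d w = us @ x # vs" and s: "subseq xs vs"
    by (auto dest: list_emb_ConsD)
  have "length us < length (drop d w)" by (simp add: dw)
  then have len: "d + length us < length w" by simp
  have "w ! (d + length us) = drop d w ! length us" using len by simp
  also have "\<dots> = x" by (simp add: dw)
  finally have x: "w ! (d + length us) = x" .
  have "drop (Suc (d + length us)) w = drop (Suc (length us)) (drop d w)"
    by (simp add: add.commute)
  also have "\<dots> = vs" by (simp add: dw)
  finally show "\<exists>i\<ge>d. i < length w \<and> w ! i = x \<and> subseq xs (drop (Suc i) w)"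
    using len x s by (intro exI[of _ "d + length us"]) simp
next
  assume "\<exists>i\<ge>d. i < length w \<and> w ! i = x \<and> subseq xs (drop (Suc i) w)"
  then obtain i where i: "d \<le> i" "i < length w" "w ! i = x" "subseq xs (drop (Suc i) w)" by blast
  then have "subseq (x # xs) (drop i w)"
    by (metis Cons_nth_drop_Suc subseq_Cons2)
  moreover have "drop i w = drop (i - d) (drop d w)" using i(1) by simp
  ultimately show "subseq (x # xs) (drop d w)"
    by (metis append_take_drop_id list_emb_append2)
qed

text \<open>In terms of subsequences, occurrences of the pattern can be split along \<open>@\<close>
  by \<open>subseq_append_iff\<close>. The names \<open>x\<close>, \<open>y\<close>,
  \<open>z\<close> follow the order of the values, so the largest letter \<open>z\<close> stands in
  the middle.\<close>

lemma avoids_132_iff_subseq: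
  "avoids_132 w \<longleftrightarrow> \<not> (\<exists>x y z. subseq [x, z, y] w \<and> x < y \<and> y < z)"
proof -
  have iff: "subseq [x, z, y] w \<longleftrightarrow>
      (\<exists>i<length w. w ! i = x \<and> (\<exists>j>i. j < length w \<and> w ! j = z \<and>
        (\<exists>k>j. k < length w \<and> w ! k = y)))" for x y z
    using subseq_Cons_drop_iff[of x "[z, y]" 0 w] by (simp add: subseq_Cons_drop_iff Suc_le_eq)
  show ?thesis
  proof (cases "avoids_132 w")
    case True
    have False if "subseq [x, z, y] w" "x < y" "y < z" for x y z
      using True that unfolding avoids_132_def iff by metis
    with True show ?thesis by blast
  next
    case False
    then obtain i j k where *: "i < j" "j < k" "k < length w" "w ! i < w ! k" "w ! k < w ! j"
      unfolding avoids_132_def by metis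
    then have "i < length w" "j < length w" by auto
    with * have "subseq [w ! i, w ! j, w ! k] w"
      unfolding iff by metis
    with * False show ?thesis by metis
  qed
qed

lemma avoids_132_sublist: "sublist u w \<Longrightarrow> avoids_132 w \<Longrightarrow> avoids_132 u"
  unfolding avoids_132_iff_subseq by (meson sublist_imp_subseq subseq_order.order_trans)

lemma subseq_setD: "subseq xs w \<Longrightarrow> x \<in> set xs \<Longrightarrow> x \<in> set w"
  by (metis set_nths_subset subseq_conv_nths subset_iff)

text \<open>Entries \<open>x\<close> of \<open>L\<close> and \<open>y\<close> of \<open>R\<close>
  with \<open>x < y\<close> would form the pattern together with \<open>N\<close>. Conversely,
  \<open>N\<close> can only play the largest letter, and an occurrence that meets both sides starts
  in \<open>L\<close> and ends in \<open>R\<close>.\<close>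

lemma avoids_132_append_max:
  assumes L: "\<And>x. x \<in> set L \<Longrightarrow> x < N" and R: "\<And>x. x \<in> set R \<Longrightarrow> x < N"
  shows "avoids_132 (L @ N # R) \<longleftrightarrow>
    avoids_132 L \<and> avoids_132 R \<and> (\<forall>x\<in>set L. \<forall>y\<in>set R. y \<le> x)"
proof (intro iffI conjI ballI)
  assume a: "avoids_132 (L @ N # R)"
  show "avoids_132 L" by (rule avoids_132_sublist[OF _ a]) auto
  show "avoids_132 R" by (rule avoids_132_sublist[OF _ a]) (metis append_Cons append_Nil sublist_append_leftI append_assoc)
  fix x y assume xy: "x \<in> set L" "y \<in> set R"
  then have "subseq ([x] @ [N, y]) (L @ N # R)"
    by (intro list_emb_append_mono) (auto simp: subseq_singleton_left)
  with a R[OF xy(2)] show "y \<le> x"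
    unfolding avoids_132_iff_subseq by (metis append_Cons append_Nil not_le)
next
  assume *: "avoids_132 L \<and> avoids_132 R \<and> (\<forall>x\<in>set L. \<forall>y\<in>set R. y \<le> x)"
  show "avoids_132 (L @ N # R)"
    unfolding avoids_132_iff_subseq
  proof safe
    fix x y z assume s: "subseq [x, z, y] (L @ N # R)" and xyz: "x < y" "y < z"
    have zN: "z \<le> N" using subseq_setD[OF s, of z] L R by force
    obtain u v where uv: "[x, z, y] = u @ v" "subseq u L" "subseq v (N # R)"
      using s unfolding subseq_append_iff by blast
    consider "u = []" | "v = []" | "u \<noteq> []" "v \<noteq> []" by blast
    then show False
    proof cases
      case 1
      then have "subseq [x, z, y] (N # R)" using uv by simp
      moreover have "x \<noteq> N" using xyz zN by simp
      ultimately have "subseq [x, z, y] R" by (simp only: subseq_Cons2_iff if_False)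
      then show ?thesis using * xyz avoids_132_iff_subseq by blast
    next
      case 2
      then have "subseq [x, z, y] L" using uv by simp
      then show ?thesis using * xyz avoids_132_iff_subseq by blast
    next
      case 3
      \<comment> \<open>Wherever the middle letter lies, the first one is in \<open>L\<close> and
        the last one in \<open>N # R\<close>; the latter is not \<open>N\<close> because
        \<open>y < z\<close> and \<open>z \<le> N\<close>.\<close>
      have "hd u = x" using uv(1) 3 by (metis hd_append2 list.sel(1))
      then have "x \<in> set L" using subseq_setD[OF uv(2)] 3 by (metis list.set_sel(1))
      have "last v = y" using uv(1) 3 by (metis last.simps last_appendR list.distinct(1))
      then have "y \<in> set (N # R)" using subseq_setD[OF uv(3)] 3 by (metis last_in_set)
      then have "y \<in> set R" using xyz zN by auto
      with \<open>x \<in> set L\<close> * xyz(1) show ?thesis by (meson leD)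
    qed
  qed
qed

subsection \<open>Binary trees and their generating functions\<close>

datatype shape = Leaf | Node shape shape

fun mirror :: "shape \<Rightarrow> shape" where
  "mirror Leaf = Leaf"
| "mirror (Node l r) = Node (mirror r) (mirror l)"

lemma size_mirror [simp]: "size (mirror t) = size t"
  by (induction t) auto

lemma mirror_eq_Leaf_iff [simp]: "mirror t = Leaf \<longleftrightarrow> t = Leaf"
  by (cases t) auto

lemma mirror_mirror [simp]: "mirror (mirror t) = t"
  by (induction t) auto

lemma size_shape_eq_0_iff [simp]: "size t = 0 \<longleftrightarrow> t = Leaf"
  by (cases t) auto

text \<open>The root accounts for one unit of size, and the rest is distributed by the size
  \<open>k\<close> of the left subtree. This serves both the finiteness proof and the convolution
  below.\<close>

lemma shapes_Suc:
  "{t. size t = Suc n \<and> (\<exists>l r. t = Node l r \<and> P l \<and> Q r)} =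
    (\<lambda>(l, r). Node l r) ` (\<Union>k\<le>n. {l. size l = k \<and> P l} \<times> {r. size r = n - k \<and> Q r})"
  by (force simp: image_iff)

lemma finite_shapes: "finite {t :: shape. size t = n}"
proof (induction n rule: less_induct)
  case (less n)
  show ?case
  proof (cases n)
    case (Suc m)
    have "{t :: shape. size t = n} =
        {t. size t = Suc m \<and> (\<exists>l r. t = Node l r \<and> True \<and> True)}"
      unfolding Suc by (auto; metis shape.exhaust shape.size(3) nat.distinct(1))
    then show ?thesis
      unfolding shapes_Suc using less Suc by auto
  qed auto
qed

lemma finite_shapes_Collect [simp]: "finite {t :: shape. size t = n \<and> P t}"
  using finite_shapes[of n] by simp

definition shape_gf :: "(shape \<Rightarrow> bool) \<Rightarrow> real fps" where
  "shape_gf P = Abs_fps (\<lambda>n. of_nat (card {t. size t = n \<and> P t}))"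

lemma shape_gf_disj:
  assumes "\<And>t. \<not> (P t \<and> Q t)"
  shows "shape_gf (\<lambda>t. P t \<or> Q t) = shape_gf P + shape_gf Q"
proof (rule fps_ext)
  fix n
  have "{t. size t = n \<and> (P t \<or> Q t)} = {t. size t = n \<and> P t} \<union> {t. size t = n \<and> Q t}"
    by auto
  then show "fps_nth (shape_gf (\<lambda>t. P t \<or> Q t)) n = fps_nth (shape_gf P + shape_gf Q) n"
    using assms by (auto simp: shape_gf_def card_Un_disjoint disjoint_iff)
qed

lemma shape_gf_Leaf: "shape_gf (\<lambda>t. t = Leaf) = 1"
proof (rule fps_ext)
  fix n
  have "{t. size t = n \<and> t = Leaf} = (if n = 0 then {Leaf} else {})" by auto
  then show "fps_nth (shape_gf (\<lambda>t. t = Leaf)) n = fps_nth 1 n" by (simp add: shape_gf_def)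
qed

text \<open>The subtrees are chosen independently and their sizes add, so the counts convolve; the
  factor \<open>fps_X\<close> stands for the root.\<close>

lemma shape_gf_Node:
  "shape_gf (\<lambda>t. \<exists>l r. t = Node l r \<and> P l \<and> Q r) = fps_X * (shape_gf P * shape_gf Q)"
proof (rule fps_ext)
  fix n
  show "fps_nth (shape_gf (\<lambda>t. \<exists>l r. t = Node l r \<and> P l \<and> Q r)) n =
      fps_nth (fps_X * (shape_gf P * shape_gf Q)) n"
  proof (cases n)
    case (Suc m)
    let ?S = "\<lambda>k. {l. size l = k \<and> P l} \<times> {r. size r = m - k \<and> Q r}"
    have "card {t. size t = n \<and> (\<exists>l r. t = Node l r \<and> P l \<and> Q r)} = card (\<Union>k\<le>m. ?S k)"
      unfolding Suc shapes_Suc by (intro card_image) (auto simp: inj_on_def)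
    also have "\<dots> = (\<Sum>k\<le>m. card (?S k))"
      by (intro card_UN_disjoint) auto
    also have "real \<dots> = fps_nth (shape_gf P * shape_gf Q) m"
      by (simp add: shape_gf_def fps_mult_nth card_cartesian_product atLeast0AtMost)
    finally show ?thesis
      by (simp add: Suc shape_gf_def)
  qed (auto simp: shape_gf_def)
qed

text \<open>For all tree classes counted below, at most two mutually exclusive alternatives at the
  root suffice; exclusiveness makes their series add up.\<close>

lemma shape_gf_rec2:
  assumes Leaf: "P Leaf"
    and Node: "\<And>l r. P (Node l r) \<longleftrightarrow> A l \<and> B r \<or> C l \<and> D r"
    and disj: "\<And>l r. \<not> (A l \<and> B r \<and> C l \<and> D r)"
  shows "shape_gf P = 1 + fps_X * (shape_gf A * shape_gf B) + fps_X * (shape_gf C * shape_gf D)"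
proof -
  let ?Q = "\<lambda>t. \<exists>l r. t = Node l r \<and> A l \<and> B r"
  let ?R = "\<lambda>t. \<exists>l r. t = Node l r \<and> C l \<and> D r"
  have "P = (\<lambda>t. (t = Leaf \<or> ?Q t) \<or> ?R t)"
  proof
    fix t show "P t \<longleftrightarrow> (t = Leaf \<or> ?Q t) \<or> ?R t"
      by (cases t) (auto simp: Leaf Node)
  qed
  moreover have "shape_gf (\<lambda>t. (t = Leaf \<or> ?Q t) \<or> ?R t) =
      shape_gf (\<lambda>t. t = Leaf \<or> ?Q t) + shape_gf ?R"
    using disj by (intro shape_gf_disj) auto
  moreover have "shape_gf (\<lambda>t. t = Leaf \<or> ?Q t) = shape_gf (\<lambda>t. t = Leaf) + shape_gf ?Q"
    by (intro shape_gf_disj) auto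
  ultimately show ?thesis
    by (simp only: shape_gf_Leaf shape_gf_Node)
qed

lemma shape_gf_False: "shape_gf (\<lambda>t. False) = 0"
  by (simp add: shape_gf_def fps_eq_iff)

lemma shape_gf_rec:
  assumes "P Leaf" "\<And>l r. P (Node l r) \<longleftrightarrow> A l \<and> B r"
  shows "shape_gf P = 1 + fps_X * (shape_gf A * shape_gf B)"
  using shape_gf_rec2[of P A B "\<lambda>_. False" "\<lambda>_. False"] assms by (simp add: shape_gf_False)

lemma shape_gf_mirror: "shape_gf (\<lambda>t. P (mirror t)) = shape_gf P"
proof (rule fps_ext)
  fix n
  have "bij_betw mirror {t. size t = n \<and> P (mirror t)} {t. size t = n \<and> P t}"
    by (rule bij_betwI[of _ _ _ mirror]) auto
  then show "fps_nth (shape_gf (\<lambda>t. P (mirror t))) n = fps_nth (shape_gf P) n"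
    by (simp add: shape_gf_def bij_betw_same_card)
qed

section \<open>The quadratic equation of the Motzkin series\<close>

lemma motzkin_fps_unique:
  assumes "A = 1 + fps_X * A + fps_X ^ 2 * A ^ 2"
  shows "motzkin_fps = A"
proof -
  define T :: "real fps" where "T = 1 - fps_X - 2 * fps_X ^ 2 * A"
  have "T ^ 2 = (1 - fps_X) ^ 2 - 4 * fps_X ^ 2 * (A - fps_X * A - fps_X ^ 2 * A ^ 2)"
    unfolding T_def by (simp add: power2_eq_square algebra_simps)
  also have "A - fps_X * A - fps_X ^ 2 * A ^ 2 = 1"
    using assms by (simp add: algebra_simps)
  finally have "T ^ Suc 1 = 1 - 2 * fps_X - 3 * fps_X ^ 2"
    by (simp add: power2_eq_square algebra_simps)
  \<comment> \<open>The constant term selects the branch of the square root: that of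
    \<open>T\<close> is 1, which equals \<open>root 2 1\<close>.\<close>
  then have "T = fps_radical root (Suc 1) (1 - 2 * fps_X - 3 * fps_X ^ 2)"
    by (subst (asm) radical_unique) (simp_all add: T_def)
  then have "1 - fps_X - fps_radical root 2 (1 - 2 * fps_X - 3 * fps_X ^ 2) = (2 * fps_X ^ 2) * A"
    unfolding T_def numeral_2_eq_2 One_nat_def by (simp add: algebra_simps)
  then show ?thesis
    unfolding motzkin_fps_def by simp
qed

subsection \<open>Trees encode 132-avoiding permutations\<close>

text \<open>The offset \<open>b\<close> keeps all subwords inside intervals of values, so nothing
  has to be standardised. Shifting the left part by \<open>size r\<close> places its values above
  those of the right part, as avoidance of 132 demands.\<close>

fun word :: "nat \<Rightarrow> shape \<Rightarrow> nat list" where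
  "word b Leaf = []"
| "word b (Node l r) = word (b + size r) l @ (b + size l + size r + 1) # word b r"

lemma length_word [simp]: "length (word b t) = size t"
  by (induction t arbitrary: b) auto

lemma set_word [simp]: "set (word b t) = {b<..b + size t}"
  by (induction t arbitrary: b) auto

lemma distinct_word [simp]: "distinct (word b t)"
  by (induction t arbitrary: b) auto

lemma word_eq_Nil_iff [simp]: "word b t = [] \<longleftrightarrow> t = Leaf"
  by (cases t) auto

lemma avoids_132_word: "avoids_132 (word b t)"
proof (induction t arbitrary: b)
  case (Node l r)
  then show ?case
    unfolding word.simps by (subst avoids_132_append_max) auto
qed (simp add: avoids_132_def)

lemma word_inject: "word b s = word b t \<Longrightarrow> s = t"
proof (induction s arbitrary: b t)
  case (Node l r)
  then obtain l' r' where t: "t = Node l' r'" by (cases t) auto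
  have "size (Node l r) = size t"
    using Node.prems by (metis length_word)
  then have N: "size l + size r = size l' + size r'" by (simp add: t)
  have "word (b + size r) l @ (b + size l + size r + 1) # word b r =
      word (b + size r') l' @ (b + size l + size r + 1) # word b r'"
    using Node.prems N by (simp add: t add.assoc)
  then have *: "word (b + size r) l = word (b + size r') l'" "word b r = word b r'"
    by (subst (asm) append_Cons_eq_iff; simp)+
  \<comment> \<open>The right subtrees come first: the offsets of the two left words agree only once
    \<open>size r = size r'\<close> is known.\<close>
  then have "r = r'" by (intro Node.IH)
  with * Node.IH t show ?case by auto
qed (metis word.simps(1) word_eq_Nil_iff)

text \<open>The cut is at the minimum of \<open>A\<close>. Applied to the two sides of the maximum,
  it shows that each side again fills an interval, so that the induction hypothesis of
  \<open>word_surj\<close> applies.\<close>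

lemma lower_part_of_interval:
  fixes A B :: "nat set"
  assumes "A \<union> B = {b<..c}" "\<And>x y. x \<in> A \<Longrightarrow> y \<in> B \<Longrightarrow> y < x"
  shows "B = {b<..b + card B} \<and> A = {b + card B<..c}"
proof -
  have fin: "finite A" "finite B" using assms(1) by (metis finite_Un finite_greaterThanAtMost)+
  show ?thesis
  proof (cases "A = {}")
    case True
    with assms(1) show ?thesis by (cases "b \<le> c") auto
  next
    case False
    define m where "m = Min A"
    have m: "m \<in> A" "\<And>x. x \<in> A \<Longrightarrow> m \<le> x" unfolding m_def using fin False by auto
    then have mb: "b < m" "m \<le> c" using assms(1) by auto
    have B: "B = {b<..<m}"
    proof (intro equalityI subsetI)
      fix x assume "x \<in> B" then show "x \<in> {b<..<m}" using assms m by auto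
    next
      fix x assume "x \<in> {b<..<m}"
      then have "x \<in> A \<union> B" "x \<notin> A" using mb m(2)[of x] assms(1) by auto
      then show "x \<in> B" by auto
    qed
    then have "b + card B = m - 1" using mb by simp
    moreover have "A = {m - 1<..c}"
    proof (intro equalityI subsetI)
      fix x assume "x \<in> A" then show "x \<in> {m - 1<..c}" using assms(1) m(2)[of x] mb by auto
    next
      fix x assume "x \<in> {m - 1<..c}"
      then have "x \<in> A \<union> B" "x \<notin> B" using mb B assms(1) by auto
      then show "x \<in> A" by auto
    qed
    ultimately show ?thesis using B mb by auto
  qed
qed

text \<open>Strong induction on the length, splitting at the maximum \<open>b + length w\<close>.
  The offset is generalised because the values of \<open>L\<close> start above
  \<open>b + length R\<close>.\<close>

lemma word_surj:
  assumes "set w = {b<..b + length w}" "distinct w" "avoids_132 w"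
  shows "\<exists>t. w = word b t"
  using assms
proof (induction w arbitrary: b rule: length_induct)
  case (1 w)
  show ?case
  proof (cases "w = []")
    case True
    then show ?thesis by (metis word.simps(1))
  next
    case False
    define N where "N = b + length w"
    have "N \<in> set w" using 1(2) False by (cases w) (auto simp: N_def)
    then obtain L R where w: "w = L @ N # R" by (meson split_list)
    have len: "length w = Suc (length L + length R)" by (simp add: w)
    then have N: "N = b + Suc (length L + length R)" by (simp add: N_def)
    have d: "distinct L" "distinct R" "set L \<inter> set R = {}" "N \<notin> set L" "N \<notin> set R"
      using 1(3) w by auto
    have "set L \<union> set R = set w - {N}" unfolding w using d by auto
    also have "\<dots> = {b<..b + (length L + length R)}" unfolding 1(2) len N by auto
    finally have LR: "set L \<union> set R = {b<..b + (length L + length R)}" .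
    have lt: "x < N" if "x \<in> set L \<union> set R" for x
      using that unfolding LR by (auto simp: N)
    have av: "avoids_132 L" "avoids_132 R" "\<forall>x\<in>set L. \<forall>y\<in>set R. y \<le> x"
      using 1(4) unfolding w by (subst (asm) avoids_132_append_max; use lt in blast)+
    then have "y < x" if "x \<in> set L" "y \<in> set R" for x y
      using that d(3) by (metis disjoint_iff nat_less_le)
    from lower_part_of_interval[OF LR this]
    have sets: "set R = {b<..b + length R}" "set L = {b + length R<..b + length R + length L}"
      using d by (auto simp: distinct_card add_ac)
    have "\<exists>t. L = word (b + length R) t" "\<exists>t. R = word b t"
      using 1(1)[rule_format, of L] 1(1)[rule_format, of R] sets d(1,2) av(1,2)
      by (simp_all add: w)
    then obtain l r where "L = word (b + length R) l" "R = word b r" by blast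
    then have "w = word b (Node l r)"
      using w N by (metis add_Suc_right length_word word.simps(2) add.assoc add.commute Suc_eq_plus1)
    then show ?thesis by blast
  qed
qed

lemma S132_eq_image_word: "S132 n = word 0 ` {t. size t = n}"
proof (intro equalityI subsetI)
  fix w assume "w \<in> S132 n"
  then have *: "set w = {1..n}" "distinct w" "avoids_132 w"
    by (auto simp: S132_def permutations_of_set_def)
  then have "length w = n" by (metis card_atLeastAtMost distinct_card diff_Suc_1)
  then show "w \<in> word 0 ` {t. size t = n}"
    using * word_surj[of w 0] by (auto simp flip: atLeastSucAtMost_greaterThanAtMost)
qed (auto simp: S132_def permutations_of_set_def avoids_132_word)

lemma card_S132_Collect:
  assumes "\<And>t. Q (word 0 t) \<longleftrightarrow> P t"
  shows "real (card {w \<in> S132 n. Q w}) = fps_nth (shape_gf P) n"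
proof -
  have "{w \<in> S132 n. Q w} = word 0 ` {t. size t = n \<and> P t}"
    unfolding S132_eq_image_word using assms by auto
  moreover have "inj_on (word 0) {t. size t = n \<and> P t}"
    using word_inject by (auto intro: inj_onI)
  ultimately show ?thesis by (simp add: card_image shape_gf_def)
qed

subsection \<open>Increasing and decreasing runs\<close>

text \<open>A longest extension is maximal. The order \<open>le\<close> is abstract so that the
  argument serves both \<open>sublist\<close> and \<open>subseq\<close>.\<close>

lemma ex_maximal_extension:
  assumes "P u" "\<And>v. P v \<Longrightarrow> length v \<le> n"
    and "\<And>x. le x x" "\<And>x y z. le x y \<Longrightarrow> le y z \<Longrightarrow> le x z"
    and "\<And>x y. le x y \<Longrightarrow> length y \<le> length x \<Longrightarrow> y = x"
  obtains v where "P v" "le u v" "\<And>v'. P v' \<Longrightarrow> le v v' \<Longrightarrow> v' = v"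
proof -
  have "\<exists>v. (P v \<and> le u v) \<and> (\<forall>v'. P v' \<and> le u v' \<longrightarrow> length v' \<le> length v)"
    by (rule ex_has_greatest_nat[of _ u _ "Suc n"]) (use assms in \<open>auto simp: less_Suc_eq_le\<close>)
  then show thesis using that assms(4,5) by metis
qed

lemma sublist_same_length: "sublist u v \<Longrightarrow> length v \<le> length u \<Longrightarrow> v = u"
  by (metis le_antisym sublist_imp_subseq sublist_length_le subseq_same_length)

text \<open>A sorted factor of length three extends to a maximal run, which is then too long;
  conversely, the first three entries of a long run form such a factor.\<close>

lemma maximal_run_length_le_2_iff:
  "(\<forall>u. maximal_run R w u \<longrightarrow> length u \<le> 2) \<longleftrightarrow>
    \<not> (\<exists>x y z. sublist [x, y, z] w \<and> sorted_wrt R [x, y, z])"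
proof safe
  fix x y z assume bound: "\<forall>u. maximal_run R w u \<longrightarrow> length u \<le> 2"
    and s: "sublist [x, y, z] w" "sorted_wrt R [x, y, z]"
  obtain v where v: "sublist v w \<and> sorted_wrt R v" "sublist [x, y, z] v"
    "\<And>v'. sublist v' w \<and> sorted_wrt R v' \<Longrightarrow> sublist v v' \<Longrightarrow> v' = v"
    by (rule ex_maximal_extension[where P = "\<lambda>v. sublist v w \<and> sorted_wrt R v" and le = sublist
          and u = "[x, y, z]" and n = "length w"])
      (use s sublist_length_le sublist_same_length sublist_order.order_trans in \<open>blast+\<close>)
  then have "maximal_run R w v"
    unfolding maximal_run_def by fastforce
  moreover have "length v \<ge> 3" using sublist_length_le[OF v(2)] by simp
  ultimately show False using bound by fastforce
next
  fix u assume no: "\<not> (\<exists>x y z. sublist [x, y, z] w \<and> sorted_wrt R [x, y, z])"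
    and u: "maximal_run R w u"
  show "length u \<le> 2"
  proof (rule ccontr)
    assume "\<not> length u \<le> 2"
    \<comment> \<open>\<open>remdups_adj.cases\<close> distinguishes empty lists, singletons and
      lists with at least two entries.\<close>
    then obtain x y z u' where [simp]: "u = [x, y, z] @ u'"
      by (cases u rule: remdups_adj.cases; force simp: neq_Nil_conv Suc_le_eq dest!: Suc_lessD)
    have "sublist u w" "sorted_wrt R u" using u by (auto simp: maximal_run_def)
    then have "sublist [x, y, z] w" "sorted_wrt R [x, y, z]"
      using sublist_order.order_trans[OF sublist_append_rightI[of "[x, y, z]" u']] by auto
    with no show False by blast
  qed
qed

section \<open>Ascents around the maximum\<close>

definition double_ascent :: "nat list \<Rightarrow> bool" where
  "double_ascent w \<longleftrightarrow> (\<exists>x y z. sublist [x, y, z] w \<and> x < y \<and> y < z)"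

definition final_ascent :: "nat list \<Rightarrow> bool" where
  "final_ascent w \<longleftrightarrow> (\<exists>x y. suffix [x, y] w \<and> x < y)"

text \<open>In a double ascent \<open>N\<close> can only be the last letter, so the new ones are
  exactly the final ascents of \<open>L\<close> extended by \<open>N\<close>.\<close>

lemma double_ascent_append_max:
  assumes L: "\<And>x. x \<in> set L \<Longrightarrow> x < N" and R: "\<And>x. x \<in> set R \<Longrightarrow> x < N"
  shows "double_ascent (L @ N # R) \<longleftrightarrow> double_ascent L \<or> final_ascent L \<or> double_ascent R"
proof
  assume "double_ascent (L @ N # R)"
  then obtain x y z where s: "sublist [x, y, z] (L @ N # R)" and xyz: "x < y" "y < z"
    unfolding double_ascent_def by blast
  have y: "y \<noteq> N" and x: "x \<noteq> N"
    using set_mono_sublist[OF s] xyz L R by fastforce+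
  consider "sublist [x, y, z] L" | "sublist [x, y, z] (N # R)"
    | u v where "[x, y, z] = u @ v" "suffix u L" "prefix v (N # R)"
    using s unfolding sublist_append by blast
  then show "double_ascent L \<or> final_ascent L \<or> double_ascent R"
  proof cases
    case 2
    then have "sublist [x, y, z] R"
      using x unfolding sublist_Cons_right by simp
    then show ?thesis using xyz unfolding double_ascent_def by blast
  next
    case 3
    \<comment> \<open>A nonempty \<open>v\<close> starts with \<open>N\<close>. Hence
      \<open>u = []\<close> would force \<open>x = N\<close>, and \<open>u = [x]\<close> would force
      \<open>y = N\<close>.\<close>
    have "u \<noteq> []" using 3(1,3) x by auto
    moreover have "u \<noteq> [x]" using 3(1,3) y by auto
    ultimately consider "u = [x, y]" | "u = [x, y, z]"
      using 3(1) by (auto simp: Cons_eq_append_conv)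
    then show ?thesis
      using 3(2) xyz suffix_imp_sublist unfolding double_ascent_def final_ascent_def
      by cases blast+
  qed (use xyz in \<open>unfold double_ascent_def, blast\<close>)
next
  have "double_ascent L \<Longrightarrow> double_ascent (L @ N # R)"
    unfolding double_ascent_def sublist_append by blast
  moreover have "double_ascent R \<Longrightarrow> double_ascent (L @ N # R)"
    unfolding double_ascent_def sublist_append sublist_Cons_right by blast
  moreover have "double_ascent (L @ N # R)" if "final_ascent L"
  proof -
    from that obtain x y where xy: "suffix [x, y] L" "x < y"
      unfolding final_ascent_def by blast
    then have "y \<in> set L" using set_mono_suffix[of "[x, y]" L] by auto
    then have "y < N" by (rule L)
    moreover have "sublist ([x, y] @ [N]) (L @ N # R)"
      unfolding sublist_append using xy(1) by (metis append_Cons append_Nil prefixI)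
    ultimately show ?thesis using xy(2) unfolding double_ascent_def append_Cons append_Nil by blast
  qed
  ultimately show "double_ascent L \<or> final_ascent L \<or> double_ascent R \<Longrightarrow> double_ascent (L @ N # R)"
    by blast
qed

text \<open>If \<open>R\<close> is empty, \<open>N\<close> ends the word and exceeds any
  predecessor. Otherwise the last two letters lie in \<open>R\<close> or form a descent from
  \<open>N\<close>.\<close>

lemma final_ascent_append_max:
  assumes L: "\<And>x. x \<in> set L \<Longrightarrow> x < N" and R: "\<And>x. x \<in> set R \<Longrightarrow> x < N"
  shows "final_ascent (L @ N # R) \<longleftrightarrow> (if R = [] then L \<noteq> [] else final_ascent R)"
proof (cases "R = []")
  case True
  have "final_ascent (L @ [N]) \<longleftrightarrow> L \<noteq> []"
  proof
    assume "L \<noteq> []"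
    then obtain L' x where "L = L' @ [x]" by (metis rev_exhaust)
    with L show "final_ascent (L @ [N])"
      by (auto simp: final_ascent_def suffix_def intro!: exI[of _ x] exI[of _ N])
  qed (auto simp: final_ascent_def suffix_def)
  then show ?thesis using True by simp
next
  case False
  have "suffix [x, y] (L @ N # R) \<longleftrightarrow> suffix [x, y] R" if "x < y" for x y
    using that False R by (auto simp: suffix_append suffix_Cons Cons_eq_append_conv)
  then show ?thesis using False unfolding final_ascent_def by auto
qed

fun shape_final_ascent :: "shape \<Rightarrow> bool" where
  "shape_final_ascent Leaf = False"
| "shape_final_ascent (Node l r) = (if r = Leaf then l \<noteq> Leaf else shape_final_ascent r)"

fun short_runs :: "shape \<Rightarrow> bool" where
  "short_runs Leaf = True"
| "short_runs (Node l r) = (short_runs l \<and> \<not> shape_final_ascent l \<and> short_runs r)"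

lemma final_ascent_word: "final_ascent (word b t) \<longleftrightarrow> shape_final_ascent t"
proof (induction t arbitrary: b)
  case (Node l r)
  then show ?case
    unfolding word.simps by (subst final_ascent_append_max) auto
qed (simp add: final_ascent_def)

lemma double_ascent_word: "\<not> double_ascent (word b t) \<longleftrightarrow> short_runs t"
proof (induction t arbitrary: b)
  case (Node l r)
  then show ?case
    unfolding word.simps by (subst double_ascent_append_max) (auto simp: final_ascent_word)
qed (simp add: double_ascent_def)

text \<open>Reversal turns \<open>L @ N # R\<close> into \<open>rev R @ N # rev L\<close>, which is
  the exchange of subtrees made by \<open>mirror\<close>. The facts about appending a maximum rest
  on the maximality of \<open>N\<close> alone, so they apply to reversed words too.\<close>

lemma final_ascent_rev_word: "final_ascent (rev (word b t)) \<longleftrightarrow> shape_final_ascent (mirror t)"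
proof (induction t arbitrary: b)
  case (Node l r)
  then show ?case
    unfolding word.simps rev_append rev.simps append_assoc append_Cons append_Nil
    by (subst final_ascent_append_max) auto
qed (simp add: final_ascent_def)

lemma double_ascent_rev_word: "\<not> double_ascent (rev (word b t)) \<longleftrightarrow> short_runs (mirror t)"
proof (induction t arbitrary: b)
  case (Node l r)
  then show ?case
    unfolding word.simps rev_append rev.simps append_assoc append_Cons append_Nil
    by (subst double_ascent_append_max) (auto simp: final_ascent_rev_word)
qed (simp add: double_ascent_def)

lemma increasing_runs_short_iff:
  "(\<forall>u. increasing_run (word b t) u \<longrightarrow> length u \<le> 2) \<longleftrightarrow> short_runs t"
proof -
  have "sorted_wrt (<) [x, y, z] \<longleftrightarrow> x < y \<and> y < z" for x y z :: nat
    by auto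
  then show ?thesis
    unfolding increasing_run_def maximal_run_length_le_2_iff double_ascent_word[symmetric, of _ b]
      double_ascent_def by (simp only:)
qed

lemma decreasing_runs_short_iff:
  "(\<forall>u. decreasing_run (word b t) u \<longrightarrow> length u \<le> 2) \<longleftrightarrow> short_runs (mirror t)"
proof -
  have "sorted_wrt (>) [x, y, z] \<longleftrightarrow> z < y \<and> y < x" for x y z :: nat
    by auto
  moreover have "sublist [x, y, z] (rev w) \<longleftrightarrow> sublist [z, y, x] w" for x y z :: nat and w
    by (simp add: sublist_rev_right)
  ultimately show ?thesis
    unfolding decreasing_run_def maximal_run_length_le_2_iff
      double_ascent_rev_word[symmetric, of _ b] double_ascent_def by (simp only:) blast
qed

lemma motzkin_fps_eq_short_runs: "motzkin_fps = shape_gf short_runs"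
proof (rule motzkin_fps_unique)
  \<comment> \<open>\<open>?B\<close> counts the good trees without final ascent, and
    \<open>?C\<close> the nonempty ones among them.\<close>
  let ?P = "\<lambda>t. short_runs t \<and> \<not> shape_final_ascent t"
  let ?A = "shape_gf short_runs" and ?B = "shape_gf ?P" and ?C = "shape_gf (\<lambda>t. ?P t \<and> t \<noteq> Leaf)"
  have A: "?A = 1 + fps_X * (?B * ?A)"
    by (rule shape_gf_rec) auto
  have B: "?B = 1 + fps_X * (1 * 1) + fps_X * (?B * ?C)"
  proof -
    \<comment> \<open>With an empty right subtree the left one must be empty too; otherwise the
      condition on the final ascent passes to the right subtree.\<close>
    have "?B = 1 + fps_X * (shape_gf (\<lambda>t. t = Leaf) * shape_gf (\<lambda>t. t = Leaf)) + fps_X * (?B * ?C)"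
      by (rule shape_gf_rec2) (auto split: if_splits)
    then show ?thesis by (simp only: shape_gf_Leaf)
  qed
  have "?P = (\<lambda>t. t = Leaf \<or> (?P t \<and> t \<noteq> Leaf))" by auto
  then have "?B = shape_gf (\<lambda>t. t = Leaf \<or> (?P t \<and> t \<noteq> Leaf))" by (rule arg_cong)
  also have "\<dots> = shape_gf (\<lambda>t. t = Leaf) + ?C"
    by (rule shape_gf_disj) auto
  finally have C: "?B = 1 + ?C" by (simp only: shape_gf_Leaf)
  \<comment> \<open>Multiplied by \<open>1 - fps_X * ?B\<close>, both \<open>?C\<close> and
    \<open>fps_X * ?A\<close> become \<open>fps_X\<close>. The factor is nonzero and can be
    cancelled, which leaves \<open>?C = fps_X * ?A\<close>.\<close>
  have "(1 - fps_X * ?B) * (?C - fps_X * ?A) =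
      (1 + ?C - 1 - fps_X * ?B * ?C) - fps_X * (?A - fps_X * (?B * ?A))"
    by (simp add: algebra_simps)
  also have "?A - fps_X * (?B * ?A) = 1" using A by (simp add: algebra_simps)
  also have "1 + ?C - 1 - fps_X * ?B * ?C = fps_X"
    using B unfolding C[symmetric] by (simp add: algebra_simps)
  finally have "(1 - fps_X * ?B) * (?C - fps_X * ?A) = 0" by simp
  moreover have "fps_nth (1 - fps_X * ?B) 0 = 1" by simp
  then have "1 - fps_X * ?B \<noteq> 0" by (metis fps_zero_nth zero_neq_one)
  ultimately have "?C = fps_X * ?A" by simp
  with A C show "?A = 1 + fps_X * ?A + fps_X ^ 2 * ?A ^ 2"
    by (simp add: algebra_simps power2_eq_square)
qed

subsection \<open>Maximal v-CIS\<close>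

lemma subseq_length_le_eq: "subseq u v \<Longrightarrow> length v \<le> length u \<Longrightarrow> v = u"
  by (metis le_antisym list_emb_length subseq_same_length)

text \<open>The argument is the one for runs, with \<open>subseq\<close> as the order and three
  consecutive values as the obstruction.\<close>

lemma maximal_v_CIS_length_le_2_iff:
  "(\<forall>u. maximal_v_CIS w u \<longrightarrow> length u \<le> 2) \<longleftrightarrow>
    \<not> (\<exists>j. subseq [j, Suc j, Suc (Suc j)] w)"
proof safe
  fix j assume bound: "\<forall>u. maximal_v_CIS w u \<longrightarrow> length u \<le> 2"
    and s: "subseq [j, Suc j, Suc (Suc j)] w"
  have "v_CIS w [j, Suc j, Suc (Suc j)]"
    unfolding v_CIS_def using s
    by (intro conjI exI[of _ j] exI[of _ 3]) (auto simp: numeral_3_eq_3 upt_conv_Cons)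
  then obtain v where v: "v_CIS w v" "subseq [j, Suc j, Suc (Suc j)] v"
    "\<And>v'. v_CIS w v' \<Longrightarrow> subseq v v' \<Longrightarrow> v' = v"
    by (rule ex_maximal_extension[where P = "v_CIS w" and le = subseq and n = "length w"])
      (auto simp: v_CIS_def list_emb_length intro: subseq_length_le_eq subseq_order.order_trans)
  then have "maximal_v_CIS w v"
    unfolding maximal_v_CIS_def by blast
  moreover have "length v \<ge> 3" using list_emb_length[OF v(2)] by simp
  ultimately show False using bound by fastforce
next
  fix u assume no: "\<not> (\<exists>j. subseq [j, Suc j, Suc (Suc j)] w)"
    and u: "maximal_v_CIS w u"
  then obtain j k where jk: "u = [j..<j + k]" "subseq u w"
    by (auto simp: maximal_v_CIS_def v_CIS_def)
  show "length u \<le> 2"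
  proof (rule ccontr)
    assume "\<not> length u \<le> 2"
    then have "u = [j, Suc j, Suc (Suc j)] @ [Suc (Suc (Suc j))..<j + k]"
      by (simp add: jk(1) upt_conv_Cons)
    then have "subseq [j, Suc j, Suc (Suc j)] u" by (metis subseq_order.order_refl subseq_rev_drop_many)
    with no jk(2) subseq_order.order_trans show False by blast
  qed
qed

fun short_v_CIS :: "shape \<Rightarrow> bool" where
  "short_v_CIS Leaf = True"
| "short_v_CIS (Node l r) = (short_v_CIS l \<and> short_v_CIS r \<and> (\<forall>a c. l = Node a c \<longrightarrow> a = Leaf))"

text \<open>\<open>Suc j\<close> is the maximum and sits at the root. The next value
  \<open>j\<close> precedes it iff the left block, which holds the higher values, is
  nonempty.\<close>

lemma subseq_top_pair_word:
  assumes "Suc j = b + size t"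
  shows "subseq [j, Suc j] (word b t) \<longleftrightarrow> (\<exists>a c. t = Node a c \<and> a \<noteq> Leaf)"
proof (cases t)
  case (Node a c)
  define A C where "A = word (b + size c) a" and "C = word b c"
  have j: "j = b + size a + size c" using assms Node by simp
  have w: "word b t = A @ Suc j # C" by (simp add: Node A_def C_def j)
  have "j \<in> set A \<longleftrightarrow> a \<noteq> Leaf"
    by (cases a) (auto simp: A_def j)
  moreover have "subseq [j, Suc j] (A @ Suc j # C) \<longleftrightarrow> j \<in> set A"
  proof
    assume "j \<in> set A"
    then have "subseq ([j] @ [Suc j]) (A @ Suc j # C)"
      by (intro list_emb_append_mono) (auto simp: subseq_singleton_left)
    then show "subseq [j, Suc j] (A @ Suc j # C)" by simp
  next
    assume "subseq [j, Suc j] (A @ Suc j # C)"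
    then obtain u v where uv: "[j, Suc j] = u @ v" "subseq u A" "subseq v (Suc j # C)"
      unfolding subseq_append_iff by blast
    show "j \<in> set A"
    proof (cases u)
      case Nil
      then have "v = [j, Suc j]" using uv(1) by simp
      with uv(3) have "subseq [j, Suc j] C" by simp
      then have "Suc j \<in> set C" using subseq_setD by fastforce
      then show ?thesis by (simp add: C_def j)
    next
      case (Cons x u')
      then show ?thesis using uv subseq_setD[of u A j] by simp
    qed
  qed
  ultimately have "subseq [j, Suc j] (word b t) \<longleftrightarrow> a \<noteq> Leaf" unfolding w by blast
  then show ?thesis by (simp add: Node)
qed simp

lemma triple_eq_append_iff:
  "[x, y, z] = u @ v \<longleftrightarrow> u = [] \<and> v = [x, y, z] \<or> u = [x] \<and> v = [y, z] \<or>
    u = [x, y] \<and> v = [z] \<or> u = [x, y, z] \<and> v = []"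
  unfolding Cons_eq_append_conv by fastforce

text \<open>Since \<open>L\<close> lies above \<open>R\<close>, an increasing triple that leaves
  \<open>L\<close> can only step to \<open>N\<close>, which must then be its last letter.\<close>

lemma short_v_CIS_word:
  "\<not> (\<exists>j. subseq [j, Suc j, Suc (Suc j)] (word b t)) \<longleftrightarrow> short_v_CIS t"
proof (induction t arbitrary: b)
  case (Node l r)
  define L R N where "L = word (b + size r) l" and "R = word b r" and "N = b + size l + size r + 1"
  have w: "word b (Node l r) = L @ N # R"
    by (simp add: L_def R_def N_def)
  have LR: "x < N" "y < N" "y < x" if "x \<in> set L" "y \<in> set R" for x y
    using that by (auto simp: L_def R_def N_def)
  have L: "x < N" if "x \<in> set L" for x using that by (auto simp: L_def N_def)
  have R: "x < N" if "x \<in> set R" for x using that by (auto simp: R_def N_def)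
  have "subseq [j, Suc j, Suc (Suc j)] (L @ N # R) \<longleftrightarrow>
      subseq [j, Suc j, Suc (Suc j)] L \<or> subseq [j, Suc j, Suc (Suc j)] R \<or>
      (subseq [j, Suc j] L \<and> Suc (Suc j) = N)" (is "_ = ?rhs") for j
  proof
    assume "subseq [j, Suc j, Suc (Suc j)] (L @ N # R)"
    then obtain u v where uv: "[j, Suc j, Suc (Suc j)] = u @ v" "subseq u L" "subseq v (N # R)"
      unfolding subseq_append_iff by blast
    from uv(1) consider "u = []" "v = [j, Suc j, Suc (Suc j)]" | "u = [j]" "v = [Suc j, Suc (Suc j)]"
      | "u = [j, Suc j]" "v = [Suc (Suc j)]" | "u = [j, Suc j, Suc (Suc j)]"
      unfolding triple_eq_append_iff by blast
    then show ?rhs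
    proof cases
      case 1
      then have "Suc (Suc j) \<in> set (N # R)" using subseq_setD[OF uv(3)] by simp
      then have "Suc (Suc j) \<le> N" using R[of "Suc (Suc j)"] by auto
      then have "j \<noteq> N" by simp
      then show ?thesis using uv(3) 1 by (simp only: subseq_Cons2_iff if_False simp_thms)
    next
      case 2
      then have "j \<in> set L" "Suc j \<in> set (N # R)" "Suc (Suc j) \<in> set (N # R)"
        using subseq_setD[OF uv(2)] subseq_setD[OF uv(3)] by auto
      \<comment> \<open>Being larger than \<open>j\<close>, the value \<open>Suc j\<close> is not in
        \<open>R\<close>, so it is \<open>N\<close>; then no room is left for
        \<open>Suc (Suc j)\<close>.\<close>
      then show ?thesis using LR(3)[of j "Suc j"] R[of "Suc (Suc j)"] by auto
    next
      case 3
      then have "j \<in> set L" "Suc (Suc j) \<in> set (N # R)"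
        using subseq_setD[OF uv(2)] subseq_setD[OF uv(3)] by auto
      then have "Suc (Suc j) = N" using LR(3)[of j "Suc (Suc j)"] by auto
      then show ?thesis using uv(2) 3 by simp
    next
      case 4
      then show ?thesis using uv(2) by simp
    qed
  next
    assume ?rhs
    then consider "subseq [j, Suc j, Suc (Suc j)] L" | "subseq [j, Suc j, Suc (Suc j)] R"
      | "subseq [j, Suc j] L" "Suc (Suc j) = N" by blast
    then show "subseq [j, Suc j, Suc (Suc j)] (L @ N # R)"
    proof cases
      case 1 then show ?thesis by (rule subseq_rev_drop_many)
    next
      case 2 then show ?thesis by (intro subseq_drop_many list_emb_Cons)
    next
      case 3
      then have "subseq ([j, Suc j] @ [N]) (L @ N # R)"
        by (intro list_emb_append_mono) (auto simp: subseq_singleton_left)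
      then show ?thesis using 3 by simp
    qed
  qed
  moreover have "(\<exists>j. subseq [j, Suc j] L \<and> Suc (Suc j) = N) \<longleftrightarrow> (\<exists>a c. l = Node a c \<and> a \<noteq> Leaf)"
  proof (cases "l = Leaf")
    case False
    \<comment> \<open>With \<open>size l = Suc k\<close>, the pair just below \<open>N\<close>
      consists of the two top values of the block of \<open>l\<close>, as
      \<open>subseq_top_pair_word\<close> requires.\<close>
    then obtain k where k: "size l = Suc k" by (cases l) auto
    then have "Suc (Suc j) = N \<longleftrightarrow> j = b + size r + k" for j by (auto simp: N_def)
    then show ?thesis
      using subseq_top_pair_word[of "b + size r + k" "b + size r" l] k by (simp add: L_def)
  qed (simp add: L_def)
  moreover have "\<not> (\<exists>j. subseq [j, Suc j, Suc (Suc j)] L) \<longleftrightarrow> short_v_CIS l"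
    unfolding L_def by (rule Node.IH)
  moreover have "\<not> (\<exists>j. subseq [j, Suc j, Suc (Suc j)] R) \<longleftrightarrow> short_v_CIS r"
    unfolding R_def by (rule Node.IH)
  ultimately show ?case
    unfolding w short_v_CIS.simps by (simp only: ex_disj_distrib) blast
qed simp

lemma maximal_v_CIS_short_iff:
  "(\<forall>u. maximal_v_CIS (word b t) u \<longrightarrow> length u \<le> 2) \<longleftrightarrow> short_v_CIS t"
  unfolding maximal_v_CIS_length_le_2_iff by (rule short_v_CIS_word)

lemma motzkin_fps_eq_short_v_CIS: "motzkin_fps = shape_gf short_v_CIS"
proof (rule motzkin_fps_unique)
  \<comment> \<open>\<open>?P\<close> is the condition on a left subtree. Its nonempty members are a
    root with empty left and good right subtree, giving \<open>1 + fps_X * A\<close> for the series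
    \<open>A\<close> of good trees.\<close>
  let ?P = "\<lambda>t. short_v_CIS t \<and> (\<forall>a c. t = Node a c \<longrightarrow> a = Leaf)"
  have "shape_gf short_v_CIS = 1 + fps_X * (shape_gf ?P * shape_gf short_v_CIS)"
    by (rule shape_gf_rec) auto
  moreover have "shape_gf ?P = 1 + fps_X * (shape_gf (\<lambda>t. t = Leaf) * shape_gf short_v_CIS)"
    by (rule shape_gf_rec) auto
  ultimately show "shape_gf short_v_CIS =
      1 + fps_X * shape_gf short_v_CIS + fps_X ^ 2 * shape_gf short_v_CIS ^ 2"
    by (simp add: shape_gf_Leaf algebra_simps power2_eq_square)
qed

subsection \<open>LDE decreasing paths\<close>

lemma rl_maxima_append_max:
  assumes "\<And>x. x \<in> set L \<Longrightarrow> x < N" "\<And>x. x \<in> set R \<Longrightarrow> x < N"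
  shows "rl_maxima (L @ N # R) = N # rl_maxima R"
  using assms by (induction L) fastforce+

lemma rl_maxima_eq_Nil_iff [simp]: "rl_maxima w = [] \<longleftrightarrow> w = []"
proof (induction w)
  case (Cons x w)
  then show ?case by (cases "w = []") auto
qed simp

lemma set_rl_maxima_subset: "set (rl_maxima w) \<subseteq> set w"
  by (induction w) auto

lemma outer_path_subset: "outer_path w p \<Longrightarrow> p \<noteq> [] \<and> set p \<subseteq> set w"
proof (induction rule: outer_path.induct)
  case (next_path w p u v)
  then show ?case using set_rl_maxima_subset[of u] by auto
qed (use set_rl_maxima_subset in auto)

lemma LDE_path_Nil: "\<not> LDE_path [] q"
proof
  assume "LDE_path [] q"
  then obtain p where "outer_path [] p" by cases auto
  then show False using outer_path_subset by fastforce
qed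

lemma append_eq_append_Cons_right:
  assumes "xs @ ys = u @ a # v" "a \<notin> set xs"
  obtains u' where "u = xs @ u'" "ys = u' @ a # v"
  using assms by (auto simp: append_eq_append_conv2 append_eq_Cons_conv)

lemma append_eq_append_Cons_left:
  assumes "xs @ ys = u @ a # v" "a \<notin> set ys"
  obtains v' where "xs = u @ a # v'" "v = v' @ ys"
  using assms by (auto simp: append_eq_append_conv2 append_eq_Cons_conv Cons_eq_append_conv)

context
  fixes L R :: "nat list" and N :: nat
  assumes dist: "distinct (L @ N # R)"
    and L: "\<And>x. x \<in> set L \<Longrightarrow> x < N" and R: "\<And>x. x \<in> set R \<Longrightarrow> x < N"
begin

text \<open>The first path starts at \<open>N\<close>, so exactly \<open>L\<close> remains to its
  left. From there the procedure runs as on \<open>L\<close> alone, each later path starting inside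
  \<open>L\<close>.\<close>

lemma outer_path_append_max:
  "outer_path (L @ N # R) p \<longleftrightarrow> p = N # rl_maxima R \<or> outer_path L p"
proof
  have first: "rl_maxima (L @ N # R) = N # rl_maxima R"
    using L R by (rule rl_maxima_append_max)
  have "outer_path w p \<Longrightarrow> w = L @ N # R \<Longrightarrow> p = N # rl_maxima R \<or> outer_path L p" for w p
  proof (induction rule: outer_path.induct)
    case (next_path w p u v)
    from next_path.IH[OF next_path.prems] show ?case
    proof
      assume p: "p = N # rl_maxima R"
      then have "L @ N # R = u @ N # v" using next_path by simp
      moreover have "N \<notin> set L" "N \<notin> set R" using dist by auto
      ultimately have "u = L" using append_Cons_eq_iff[of N L R u v] by blast
      then show ?thesis using next_path.hyps outer_path.first_path by blast
    next
      assume p: "outer_path L p"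
      then have "hd p \<in> set L" using outer_path_subset[OF p] by (cases p) auto
      then have "hd p \<notin> set (N # R)" using dist by auto
      moreover have "L @ N # R = u @ hd p # v" using next_path by simp
      ultimately obtain v' where "L = u @ hd p # v'" by (metis append_eq_append_Cons_left)
      then show ?thesis using p next_path.hyps outer_path.next_path by blast
    qed
  qed (simp add: first)
  then show "outer_path (L @ N # R) p \<Longrightarrow> p = N # rl_maxima R \<or> outer_path L p" by blast
  have N: "outer_path (L @ N # R) (N # rl_maxima R)"
    using outer_path.first_path[of "L @ N # R"] by (simp add: first)
  have "outer_path w p \<Longrightarrow> w = L \<Longrightarrow> outer_path (L @ N # R) p" for w p
  proof (induction rule: outer_path.induct)
    case (first_path w)
    then show ?case using outer_path.next_path[OF N, of L R] by simp
  next
    case (next_path w p u v)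
    then show ?case using outer_path.next_path[of "L @ N # R" p u "v @ N # R"] by simp
  qed
  with N show "p = N # rl_maxima R \<or> outer_path L p \<Longrightarrow> outer_path (L @ N # R) p" by blast
qed

text \<open>Both ends of a gap belong to one outer path. Gaps of the path through \<open>N\<close>
  therefore lie within \<open>N # R\<close>, and all others within \<open>L\<close>.\<close>

lemma LDE_path_append_max:
  "LDE_path (L @ N # R) q \<longleftrightarrow> q = N # rl_maxima R \<or> LDE_path L q \<or>
    (\<exists>xs a b ys u g v. N # rl_maxima R = xs @ a # b # ys \<and> N # R = u @ a # g @ b # v \<and>
      g \<noteq> [] \<and> LDE_path g q)" (is "_ \<longleftrightarrow> ?rhs")
proof
  assume "LDE_path (L @ N # R) q"
  then show ?rhs
  proof cases
    case outer
    then show ?thesis unfolding outer_path_append_max using LDE_path.outer by blast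
  next
    case (gap p xs a b ys u g v)
    from gap(1) consider "p = N # rl_maxima R" | "outer_path L p"
      unfolding outer_path_append_max by blast
    then show ?thesis
    proof cases
      case 1
      have "a \<in> set (N # R)" using 1 gap(2) set_rl_maxima_subset[of R]
        by (metis in_set_conv_decomp insert_iff list.simps(15) subsetD)
      then have "a \<notin> set L" using dist by auto
      with gap(3) obtain u' where "N # R = u' @ a # g @ b # v"
        by (metis append_eq_append_Cons_right)
      then show ?thesis using 1 gap by blast
    next
      case 2
      have "b \<in> set L" using outer_path_subset[OF 2] gap(2) by auto
      then have "b \<notin> set (N # R)" using dist by auto
      moreover have "L @ N # R = (u @ a # g) @ b # v" using gap(3) by simp
      ultimately obtain v' where "L = (u @ a # g) @ b # v'"
        by (metis append_eq_append_Cons_left)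
      then have "L = u @ a # g @ b # v'" by simp
      then show ?thesis using 2 gap LDE_path.gap by blast
    qed
  qed
next
  assume ?rhs
  then consider "q = N # rl_maxima R" | "LDE_path L q"
    | xs a b ys u g v where "N # rl_maxima R = xs @ a # b # ys" "N # R = u @ a # g @ b # v"
      "g \<noteq> []" "LDE_path g q" by blast
  then show "LDE_path (L @ N # R) q"
  proof cases
    case 1
    then show ?thesis using outer_path_append_max LDE_path.outer by blast
  next
    case 2
    then show ?thesis
    proof cases
      case outer
      then show ?thesis using outer_path_append_max LDE_path.outer by blast
    next
      case (gap p xs a b ys u g v)
      then have "L @ N # R = u @ a # g @ b # (v @ N # R)" by simp
      moreover have "outer_path (L @ N # R) p" using gap outer_path_append_max by blast
      ultimately show ?thesis using gap LDE_path.gap by blast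
    qed
  next
    case 3
    have "L @ N # R = (L @ u) @ a # g @ b # v" using 3(2) by simp
    moreover have "outer_path (L @ N # R) (N # rl_maxima R)" using outer_path_append_max by blast
    ultimately show ?thesis using 3 LDE_path.gap by blast
  qed
qed

end

fun short_LDE :: "shape \<Rightarrow> bool" where
  "short_LDE Leaf = True"
| "short_LDE (Node l Leaf) = short_LDE l"
| "short_LDE (Node l (Node a c)) = (short_LDE l \<and> short_LDE a \<and> c = Leaf)"

text \<open>The path through \<open>N\<close> is short iff the part after \<open>N\<close> is empty
  or ends with its maximum \<open>M\<close>. In the latter case the entries between \<open>N\<close>
  and \<open>M\<close> form the only possible gap of that path.\<close>

lemma LDE_paths_short_iff:
  "(\<forall>p. LDE_path (word b t) p \<longrightarrow> length p \<le> 2) \<longleftrightarrow> short_LDE t"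
proof (induction t arbitrary: b rule: short_LDE.induct)
  case 1
  then show ?case by (simp add: LDE_path_Nil)
next
  case (2 l)
  define L N where "L = word b l" and "N = b + size l + 1"
  have "LDE_path (L @ N # []) q \<longleftrightarrow> q = [N] \<or> LDE_path L q" for q
    by (subst LDE_path_append_max) (auto simp: L_def N_def Cons_eq_append_conv)
  then have "LDE_path (word b (Node l Leaf)) q \<longleftrightarrow> q = [N] \<or> LDE_path L q" for q
    by (simp add: L_def N_def)
  then show ?case using 2[of b] by (auto simp: L_def)
next
  case (3 l a c)
  define L N A M C where "L = word (b + size (Node a c)) l"
    and "N = b + size l + size (Node a c) + 1"
    and "A = word (b + size c) a" and "M = b + size a + size c + 1" and "C = word b c"
  have w: "word b (Node l (Node a c)) = L @ N # A @ M # C"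
    by (simp add: L_def N_def A_def M_def C_def)
  have A: "x < M" if "x \<in> set A" for x using that by (auto simp: A_def M_def)
  have C: "x < M" if "x \<in> set C" for x using that by (auto simp: C_def M_def)
  have max: "rl_maxima (A @ M # C) = M # rl_maxima C"
    using A C by (rule rl_maxima_append_max)
  have dist: "distinct (L @ N # A @ M # C)" unfolding w[symmetric] by (rule distinct_word)
  have path: "LDE_path (word b (Node l (Node a c))) q \<longleftrightarrow>
      q = N # M # rl_maxima C \<or> LDE_path L q \<or>
    (\<exists>xs d e ys u g v. N # M # rl_maxima C = xs @ d # e # ys \<and> N # A @ M # C = u @ d # g @ e # v \<and>
      g \<noteq> [] \<and> LDE_path g q)" for q
    unfolding w max[symmetric] by (rule LDE_path_append_max[OF dist])
      (auto simp: L_def N_def A_def M_def C_def)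
  show ?case
  proof (cases "c = Leaf")
    case False
    then have "\<not> length (N # M # rl_maxima C) \<le> 2" by (cases "rl_maxima C") (auto simp: C_def)
    then show ?thesis using path False by auto
  next
    case True
    then have [simp]: "C = []" by (simp add: C_def)
    have "(\<exists>xs d e ys u g v. N # M # rl_maxima C = xs @ d # e # ys \<and>
        N # A @ M # C = u @ d # g @ e # v \<and> g \<noteq> [] \<and> LDE_path g q) \<longleftrightarrow> LDE_path A q" (is "?lhs \<longleftrightarrow> _") for q
    proof
      assume ?lhs
      then obtain xs d e ys u g v where *: "[N, M] = xs @ d # e # ys"
        "N # A @ [M] = u @ d # g @ e # v" "LDE_path g q" by auto
      \<comment> \<open>The path consists of \<open>N\<close> and \<open>M\<close> only. As each
        occurs once in the word, the gap between them is \<open>A\<close>.\<close>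
      then have de: "d = N" "e = M" by (auto simp: Cons_eq_append_conv)
      then have "[] @ N # (A @ [M]) = u @ N # (g @ M # v)" using * by simp
      moreover have "N \<notin> set []" "N \<notin> set (A @ [M])" using dist by auto
      ultimately have "A @ M # [] = g @ M # v"
        using append_Cons_eq_iff[of N "[]" "A @ [M]" u "g @ M # v"] by blast
      moreover have "M \<notin> set A" "M \<notin> set []" using dist by auto
      ultimately have "A = g"
        using append_Cons_eq_iff[of M A "[]" g v] by blast
      then show "LDE_path A q" using * by simp
    next
      assume q: "LDE_path A q"
      then have "A \<noteq> []" using LDE_path_Nil by auto
      with q show ?lhs
        by (intro exI[of _ "[]"] exI[of _ N] exI[of _ M] exI[of _ A]) auto
    qed
    with path have "LDE_path (word b (Node l (Node a c))) q \<longleftrightarrow>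
        q = [N, M] \<or> LDE_path L q \<or> LDE_path A q" for q
      by simp
    then show ?thesis
      using 3(1)[of "b + size (Node a c)"] 3(2)[of "b + size c"] True
      by (auto simp: L_def A_def)
  qed
qed

lemma motzkin_fps_eq_short_LDE: "motzkin_fps = shape_gf short_LDE"
proof (rule motzkin_fps_unique)
  \<comment> \<open>\<open>?P\<close> describes the nonempty right subtrees allowed. Its conjunct
    \<open>c = Leaf\<close> fits the shape of \<open>shape_gf_Node\<close> and contributes the
    factor 1.\<close>
  let ?A = "shape_gf short_LDE" and ?P = "\<lambda>t. \<exists>a c. t = Node a c \<and> short_LDE a \<and> c = Leaf"
  have "?A = 1 + fps_X * (?A * shape_gf (\<lambda>t. t = Leaf)) + fps_X * (?A * shape_gf ?P)"
  proof (rule shape_gf_rec2)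
    fix l r
    show "short_LDE (Node l r) \<longleftrightarrow> short_LDE l \<and> r = Leaf \<or> short_LDE l \<and> ?P r"
      by (cases r) auto
  qed auto
  moreover have "shape_gf ?P = fps_X * (?A * shape_gf (\<lambda>t. t = Leaf))"
    by (rule shape_gf_Node)
  ultimately show "?A = 1 + fps_X * ?A + fps_X ^ 2 * ?A ^ 2"
    by (simp add: shape_gf_Leaf algebra_simps power2_eq_square)
qed

theorem corollary5p2:
  fixes n :: nat
  assumes "n \<ge> 1"
  shows "real (card {w \<in> S132 n. \<forall>u. increasing_run w u \<longrightarrow> length u \<le> 2}) = motzkin n \<and>
         real (card {w \<in> S132 n. \<forall>p. LDE_path w p \<longrightarrow> length p \<le> 2}) = motzkin n \<and>
         real (card {w \<in> S132 n. \<forall>u. maximal_v_CIS w u \<longrightarrow> length u \<le> 2}) = motzkin n \<and>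
         real (card {w \<in> S132 n. \<forall>u. decreasing_run w u \<longrightarrow> length u \<le> 2}) = motzkin n"
proof (intro conjI)
  show "real (card {w \<in> S132 n. \<forall>u. increasing_run w u \<longrightarrow> length u \<le> 2}) = motzkin n"
    unfolding motzkin_def motzkin_fps_eq_short_runs
    by (rule card_S132_Collect) (rule increasing_runs_short_iff)
  show "real (card {w \<in> S132 n. \<forall>p. LDE_path w p \<longrightarrow> length p \<le> 2}) = motzkin n"
    unfolding motzkin_def motzkin_fps_eq_short_LDE
    by (rule card_S132_Collect) (rule LDE_paths_short_iff)
  show "real (card {w \<in> S132 n. \<forall>u. maximal_v_CIS w u \<longrightarrow> length u \<le> 2}) = motzkin n"
    unfolding motzkin_def motzkin_fps_eq_short_v_CIS
    by (rule card_S132_Collect) (rule maximal_v_CIS_short_iff)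
  show "real (card {w \<in> S132 n. \<forall>u. decreasing_run w u \<longrightarrow> length u \<le> 2}) = motzkin n"
    \<comment> \<open>Reflection preserves size, so trees with a good mirror image are as numerous
      as good trees.\<close>
    unfolding motzkin_def motzkin_fps_eq_short_runs shape_gf_mirror[of short_runs, symmetric]
    by (rule card_S132_Collect) (rule decreasing_runs_short_iff)
qed

end
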